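(* Let $G$ be a connected graph of maximum degree $\Delta\ge1$ and degeneracy $k$. Then $\chi_{\rm pcf}(G)\le 2\Delta+\lfloor k/2\rfloor$, with equality if and only if $G=K_2$ or $G=C_5$.
   Context: All graphs are simple, finite and undirected. A vertex coloring of a graph is proper if adjacent vertices get distinct colors. It is conflict-free (with respect to open neighborhoods) if for every non-isolated vertex $x$ there is a color that appears exactly once on the open neighborhood $N(x)$. A PCF $k$-coloring is a vertex coloring with at most $k$ colors that is both proper and conflict-free. The PCF chromatic number $\chi_{\rm pcf}(G)$ is the minimum $k$ for which $G$ admits a PCF $k$-coloring. The degeneracy of $G$ (called "degenericity" in the paper) is the smallest integer $k$ such that every subgraph of $G$ with at least one vertex has a vertex of degree at most $k$ in that subgraph. Equality of graphs such as $G=K_2$ is understood up to isomorphism. *)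

theory Defs
  imports "Graph_Theory.Graph_Theory"
begin

text \<open>
  A finite simple undirected graph is a \<^locale>\<open>pair_graph\<close>: a finite digraph without
  loops whose arc relation \<^const>\<open>parcs\<close> is symmetric, so that the undirected edge
  \<open>{u, v}\<close> is represented by the two arcs \<open>(u, v)\<close> and \<open>(v, u)\<close>. The degree of a vertex
  is therefore its \<^const>\<open>out_degree\<close>.
\<close>

definition neighborhood :: "'a pair_pre_digraph \<Rightarrow> 'a \<Rightarrow> 'a set" where
  "neighborhood G x = {y. (x, y) \<in> parcs G}"

definition max_degree :: "'a pair_pre_digraph \<Rightarrow> nat" where
  "max_degree G = Max (out_degree (with_proj G) ` pverts G)"

text \<open>
  \<^const>\<open>subgraph\<close> alone would also admit subdigraphs that contain only one of the two arcs
  of an edge; the condition \<^term>\<open>pair_graph H\<close> excludes them.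
\<close>

definition degeneracy :: "'a pair_pre_digraph \<Rightarrow> nat" where
  "degeneracy G = (LEAST k. \<forall>H. pair_graph H \<and> subgraph (with_proj H) (with_proj G) \<and> pverts H \<noteq> {}
     \<longrightarrow> (\<exists>v\<in>pverts H. out_degree (with_proj H) v \<le> k))"

definition proper_coloring :: "'a pair_pre_digraph \<Rightarrow> ('a \<Rightarrow> 'c) \<Rightarrow> bool" where
  "proper_coloring G c \<longleftrightarrow> (\<forall>(x, y)\<in>parcs G. c x \<noteq> c y)"

definition conflict_free_coloring :: "'a pair_pre_digraph \<Rightarrow> ('a \<Rightarrow> 'c) \<Rightarrow> bool" where
  "conflict_free_coloring G c \<longleftrightarrow>
     (\<forall>x\<in>pverts G. neighborhood G x \<noteq> {} \<longrightarrow> (\<exists>a. card {y \<in> neighborhood G x. c y = a} = 1))"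

definition pcf_coloring :: "'a pair_pre_digraph \<Rightarrow> nat \<Rightarrow> ('a \<Rightarrow> 'c) \<Rightarrow> bool" where
  "pcf_coloring G k c \<longleftrightarrow>
     card (c ` pverts G) \<le> k \<and> proper_coloring G c \<and> conflict_free_coloring G c"

text \<open>
  Taking the colors to be natural numbers is no restriction for a finite graph.
\<close>

definition pcf_chromatic_number :: "'a pair_pre_digraph \<Rightarrow> nat" where
  "pcf_chromatic_number G = (LEAST k. \<exists>c :: 'a \<Rightarrow> nat. pcf_coloring G k c)"

text \<open>The cycle graph; only meaningful for \<^term>\<open>n \<ge> 3\<close>.\<close>

definition cycle_graph :: "nat \<Rightarrow> nat pair_pre_digraph" where
  "cycle_graph n = \<lparr> pverts = {..<n},
     parcs = {(u, v). u < n \<and> v < n \<and> (v = Suc u mod n \<or> u = Suc v mod n)} \<rparr>"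

lemma pair_graph_cycle_graph:
  assumes "n \<ge> 3"
  shows "pair_graph (cycle_graph n)"
proof -
  have "parcs (cycle_graph n) \<subseteq> {..<n} \<times> {..<n}"
    by (auto simp: cycle_graph_def)
  then have "finite (parcs (cycle_graph n))"
    by (rule finite_subset) simp
  moreover have "Suc u mod n \<noteq> u" if "u < n" for u
    using that assms by (cases "Suc u = n") auto
  ultimately show ?thesis
    by unfold_locales (auto simp: cycle_graph_def symmetric_def sym_def dest: sym)
qed

lemma (in pair_graph) ex_pcf_coloring: "\<exists>k (c :: 'a \<Rightarrow> nat). pcf_coloring G k c"
proof -
  obtain c :: "'a \<Rightarrow> nat" where c: "inj_on c (pverts G)"
    using finite_imp_inj_to_nat_seg[OF pair_finite_verts] by blast
  have "proper_coloring G c"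
    unfolding proper_coloring_def
    using c pair_no_loops by (fastforce dest: in_arcsD1 in_arcsD2 inj_onD)
  moreover have "conflict_free_coloring G c"
    unfolding conflict_free_coloring_def
  proof (intro ballI impI)
    fix x assume "neighborhood G x \<noteq> {}"
    then obtain y where y: "y \<in> neighborhood G x" by blast
    then have "{z \<in> neighborhood G x. c z = c y} = {y}"
      using c by (auto simp: neighborhood_def dest: in_arcsD2 inj_onD)
    then show "\<exists>a. card {z \<in> neighborhood G x. c z = a} = 1"
      by (intro exI[of _ "c y"]) simp
  qed
  ultimately show ?thesis
    unfolding pcf_coloring_def by blast
qed

end

theory Submission
  imports Defs
begin

text \<open>
  Color greedily, fixing for each vertex \<open>x\<close> a witness color that occurs once on the colored part
  of \<open>N(x)\<close>. A new vertex has to avoid the colors of its colored neighbors, at most \<open>d\<close> of them in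
  a \<open>d\<close>-degenerate order, and the witnesses of all its neighbors, at most \<open>\<Delta>\<close>. So \<open>\<Delta> + d + 1\<close>
  colors suffice; the choices \<open>d = k\<close> and \<open>d = \<Delta>\<close> settle \<open>\<Delta> \<ge> 4\<close>.

  For \<open>\<Delta> = 3\<close> six colors are enough. If the graph is not cubic then it is 2-degenerate. If it is
  cubic, then color \<open>G - r\<close> greedily. When no color is left for \<open>r\<close>, the three neighbors of \<open>r\<close> and
  their three (monochromatic) remaining neighborhoods show six different colors, and a neighbor \<open>u\<close>
  of \<open>r\<close> is so weakly constrained that it can be recolored; \<open>r\<close> then takes the old color of \<open>u\<close>.

  For \<open>\<Delta> = 2\<close> the graph is a path or a cycle, and its square has a 3-coloring or, unless it is
  \<open>C\<^sub>5\<close>, a 4-coloring.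
\<close>

section \<open>Colorings of a set in which some color occurs exactly once\<close>

definition uniquely_colored :: "('a \<Rightarrow> 'c) \<Rightarrow> 'a set \<Rightarrow> bool" where
  "uniquely_colored c A \<longleftrightarrow> (\<exists>y\<in>A. \<forall>z\<in>A. c z = c y \<longrightarrow> z = y)"

lemma uniquely_colored_iff_card:
  "uniquely_colored c A \<longleftrightarrow> (\<exists>a. card {y \<in> A. c y = a} = 1)"
proof
  assume "uniquely_colored c A"
  then obtain y where "y \<in> A" "\<forall>z\<in>A. c z = c y \<longrightarrow> z = y"
    unfolding uniquely_colored_def by blast
  then have "{z \<in> A. c z = c y} = {y}" by auto
  then show "\<exists>a. card {y \<in> A. c y = a} = 1" by (intro exI[of _ "c y"]) simp
next
  assume "\<exists>a. card {y \<in> A. c y = a} = 1"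
  then obtain a y where "{z \<in> A. c z = a} = {y}" by (metis card_1_singletonE)
  then have "y \<in> A" "c y = a" "\<And>z. z \<in> A \<Longrightarrow> c z = a \<Longrightarrow> z = y" by blast+
  then show "uniquely_colored c A" unfolding uniquely_colored_def by metis
qed

lemma uniquely_colored_cong:
  assumes "\<And>y. y \<in> A \<Longrightarrow> c y = c' y"
  shows "uniquely_colored c A \<longleftrightarrow> uniquely_colored c' A"
  using assms unfolding uniquely_colored_def by auto

lemma uniquely_colored_inj_on: "inj_on c A \<Longrightarrow> A \<noteq> {} \<Longrightarrow> uniquely_colored c A"
  unfolding uniquely_colored_def inj_on_def by blast

text \<open>The third element can share its color with at most one of \<open>p\<close> and
  \<open>q\<close>, and if it does, the other one stands alone. For neighborhoods in a cubic graph
  the conflict-free condition thus reduces to not being monochromatic.\<close>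

lemma uniquely_colored_card3:
  assumes "card A = 3" "p \<in> A" "q \<in> A" "c p \<noteq> c q"
  shows "uniquely_colored c A"
proof -
  have "card (A - {p, q}) = 1"
    using assms by (subst card_Diff_subset) (auto simp: card_insert_if)
  then obtain u where "A - {p, q} = {u}" by (auto simp: card_1_singleton_iff)
  with assms have "A = {p, q, u}" "u \<noteq> p" "u \<noteq> q" by auto
  with assms show ?thesis
    unfolding uniquely_colored_def by (cases "c u = c p") auto
qed

lemma uniquely_colored_two_colors:
  assumes "uniquely_colored c A" "card A \<ge> 2"
  obtains p q where "p \<in> A" "q \<in> A" "c p \<noteq> c q"
proof -
  obtain y where y: "y \<in> A" "\<forall>z\<in>A. c z = c y \<longrightarrow> z = y"
    using assms unfolding uniquely_colored_def by blast
  have "A \<noteq> {y}" using assms by auto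
  with y(1) obtain z where "z \<in> A" "z \<noteq> y" by auto
  with y that show thesis by metis
qed

lemma ex_color_less:
  fixes F :: "nat set"
  assumes "finite F" "card F < m"
  obtains a where "a < m" "a \<notin> F"
proof -
  have "\<not> {..<m} \<subseteq> F" using card_mono[OF assms(1), of "{..<m}"] assms(2) by auto
  with that show thesis by auto
qed

lemma out_degree_with_proj: "out_degree (with_proj G) x = card (neighborhood G x)"
proof -
  have "out_arcs (with_proj G) x = Pair x ` neighborhood G x"
    by (auto simp: out_arcs_def neighborhood_def)
  then show ?thesis by (simp add: out_degree_def card_image inj_on_def)
qed

section \<open>Neighborhoods, connectivity and degeneracy\<close>

context pair_graph
begin

abbreviation "V \<equiv> pverts G"
abbreviation "N \<equiv> neighborhood G"

lemma neighborhood_sym: "y \<in> N x \<longleftrightarrow> x \<in> N y"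
  by (auto simp: neighborhood_def intro: arcs_symmetric)

lemma neighborhood_irrefl: "x \<notin> N x"
  using pair_no_loops by (fastforce simp: neighborhood_def)

lemma neighborhood_subset: "N x \<subseteq> V"
  by (auto simp: neighborhood_def dest: in_arcsD2)

lemma finite_neighborhood: "finite (N x)"
  using finite_subset[OF neighborhood_subset pair_finite_verts] .

lemma card_neighborhood_le: "x \<in> V \<Longrightarrow> card (N x) \<le> max_degree G"
  unfolding max_degree_def out_degree_with_proj by (rule Max_ge) (auto simp: pair_finite_verts)

text \<open>The arc relation is symmetric, so connectedness yields a directed path between any two
  vertices, and no path leaves a set that is closed under adjacency.\<close>

lemma connected_closed_eq:
  assumes conn: "Digraph_Component.connected (with_proj G)"
    and T: "T \<subseteq> V" "T \<noteq> {}" and closed: "\<And>x. x \<in> T \<Longrightarrow> N x \<subseteq> T"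
  shows "T = V"
proof -
  have "strongly_connected (with_proj G)"
    using symmetric_connected_imp_strongly_connected[OF pair_sym_arcs conn] .
  then have reach: "(u, v) \<in> rtrancl_on V (parcs G)" if "u \<in> V" "v \<in> V" for u v
    using that by (auto simp: strongly_connected_def reachable_def)
  obtain u where u: "u \<in> T" using T by auto
  have "v \<in> T" if "v \<in> V" for v
  proof -
    have "(u, v) \<in> rtrancl_on V (parcs G)" using reach u T that by auto
    then show ?thesis
    proof (induction rule: rtrancl_on_induct)
      case base show ?case by (rule u)
    next
      case (step y z)
      then show ?case using closed[of y] by (auto simp: neighborhood_def)
    qed
  qed
  with T show ?thesis by auto
qed

text \<open>Names the predicate under \<open>LEAST\<close> in \<open>degeneracy\<close>, so that
  \<open>LeastI\<close> can be applied to it.\<close>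

definition sub_degenerate :: "nat \<Rightarrow> bool" where
  "sub_degenerate k \<longleftrightarrow> (\<forall>H. pair_graph H \<and> subgraph (with_proj H) (with_proj G) \<and> pverts H \<noteq> {}
     \<longrightarrow> (\<exists>v\<in>pverts H. out_degree (with_proj H) v \<le> k))"

lemma sub_degenerate_max_degree: "sub_degenerate (max_degree G)"
  unfolding sub_degenerate_def
proof (intro allI impI, elim conjE)
  fix H assume H: "pair_graph H" "subgraph (with_proj H) (with_proj G)" "pverts H \<noteq> {}"
  then obtain v where v: "v \<in> pverts H" by auto
  have "neighborhood H v \<subseteq> N v" "v \<in> V"
    using H(2) v by (auto simp: neighborhood_def subgraph_def)
  then have "card (neighborhood H v) \<le> max_degree G"
    using card_mono[OF finite_neighborhood] card_neighborhood_le order_trans by blast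
  with v show "\<exists>v\<in>pverts H. out_degree (with_proj H) v \<le> max_degree G"
    unfolding out_degree_with_proj by blast
qed

lemma degeneracy_le_max_degree: "degeneracy G \<le> max_degree G"
  unfolding degeneracy_def using sub_degenerate_max_degree[unfolded sub_degenerate_def]
  by (rule Least_le)

lemma sub_degenerate_degeneracy: "sub_degenerate (degeneracy G)"
  using LeastI[of sub_degenerate, OF sub_degenerate_max_degree]
  unfolding degeneracy_def sub_degenerate_def .

text \<open>Applies the definition to the subgraph induced on \<open>T\<close>, so that the greedy
  argument can work with vertex sets alone.\<close>

lemma degeneracy_subset:
  assumes "T \<subseteq> V" "T \<noteq> {}"
  shows "\<exists>v\<in>T. card (N v \<inter> T) \<le> degeneracy G"
proof -
  define H where "H = \<lparr>pverts = T, parcs = parcs G \<inter> T \<times> T\<rparr>"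
  have "finite T" using assms pair_finite_verts finite_subset by blast
  then have H: "pair_graph H"
    by unfold_locales
      (auto simp: H_def symmetric_def sym_def dest: arcs_symmetric no_loops')
  then interpret H: pair_graph H .
  have "wf_digraph (with_proj H)" "wf_digraph (with_proj G)" by unfold_locales
  then have "subgraph (with_proj H) (with_proj G)"
    using assms by (auto simp: subgraph_def compatible_def H_def)
  moreover have "pverts H = T" by (simp add: H_def)
  ultimately obtain v where "v \<in> T" "card (neighborhood H v) \<le> degeneracy G"
    using H assms sub_degenerate_degeneracy
    unfolding sub_degenerate_def out_degree_with_proj by blast
  moreover from this have "neighborhood H v = N v \<inter> T"
    by (auto simp: neighborhood_def H_def)
  ultimately show ?thesis by auto
qed

section \<open>Greedy coloring\<close>

text \<open>Only the colors on \<open>S\<close> matter, but vertices outside \<open>S\<close> need a witness color as well.\<close>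

definition pcf_on :: "'a set \<Rightarrow> ('a \<Rightarrow> nat) \<Rightarrow> bool" where
  "pcf_on S c \<longleftrightarrow> (\<forall>x\<in>S. \<forall>y\<in>N x \<inter> S. c x \<noteq> c y) \<and>
     (\<forall>x\<in>V. N x \<inter> S \<noteq> {} \<longrightarrow> uniquely_colored c (N x \<inter> S))"

lemma pcf_chromatic_number_le:
  assumes "pcf_on V c" "c ` V \<subseteq> {..<m}"
  shows "pcf_chromatic_number G \<le> m"
proof -
  have "N x \<inter> V = N x" for x using neighborhood_subset by auto
  then have "pcf_coloring G m c"
    using assms card_mono[OF _ assms(2)] in_arcsD1 in_arcsD2
    unfolding pcf_coloring_def proper_coloring_def conflict_free_coloring_def pcf_on_def
      uniquely_colored_iff_card by (auto simp: neighborhood_def)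
  then show ?thesis unfolding pcf_chromatic_number_def by (intro Least_le) blast
qed

lemma pcf_chromatic_number_coloring:
  obtains c :: "'a \<Rightarrow> nat" where "pcf_coloring G (pcf_chromatic_number G) c"
  using LeastI_ex[OF ex_pcf_coloring] unfolding pcf_chromatic_number_def by blast

text \<open>By induction on \<open>S\<close>, a vertex with at most \<open>d\<close> neighbors in
  \<open>S\<close> is taken out and colored last; the degenerate order itself is never
  constructed.\<close>

lemma greedy_pcf_on:
  assumes "S \<subseteq> V" "\<And>v. v \<in> V \<Longrightarrow> card (N v) \<le> D"
    and "\<And>T. T \<subseteq> S \<Longrightarrow> T \<noteq> {} \<Longrightarrow> \<exists>v\<in>T. card (N v \<inter> T) \<le> d"
  shows "\<exists>c. c ` S \<subseteq> {..<D + d + 1} \<and> pcf_on S c"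
proof -
  have "finite S" using assms(1) pair_finite_verts finite_subset by blast
  then show ?thesis using assms(1,3)
  proof (induction S rule: finite_psubset_induct)
    case (psubset S)
    show ?case
    proof (cases "S = {}")
      case True then show ?thesis by (auto simp: pcf_on_def)
    next
      case False
      then obtain v where v: "v \<in> S" "card (N v \<inter> S) \<le> d" using psubset.prems(2)[of S] by auto
      define S' where "S' = S - {v}"
      have "S' \<subset> S" "S' \<subseteq> V" using v psubset.prems S'_def by auto
      then obtain c where c: "c ` S' \<subseteq> {..<D + d + 1}" "pcf_on S' c"
        using psubset.IH[of S'] psubset.prems(2) by auto
      have "\<exists>y. y \<in> N x \<inter> S' \<and> (\<forall>z\<in>N x \<inter> S'. c z = c y \<longrightarrow> z = y)"
        if "x \<in> V" "N x \<inter> S' \<noteq> {}" for x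
        using c(2) that unfolding pcf_on_def uniquely_colored_def by blast
      \<comment> \<open>One witness is fixed for each vertex that has a colored neighbor; elsewhere
        \<open>w\<close> is arbitrary.\<close>
      then obtain w where w: "\<And>x. x \<in> V \<Longrightarrow> N x \<inter> S' \<noteq> {} \<Longrightarrow>
          w x \<in> N x \<inter> S' \<and> (\<forall>z\<in>N x \<inter> S'. c z = c (w x) \<longrightarrow> z = w x)"
        by metis
      \<comment> \<open>The first part keeps the coloring proper, the second keeps every witness
        color unique. An arbitrary value of \<open>w\<close> at a neighbor without colored neighbors
        only forbids one color more, and the count allows one for each neighbor of
        \<open>v\<close>.\<close>
      define F where "F = c ` (N v \<inter> S) \<union> (\<lambda>x. c (w x)) ` N v"
      have "card F \<le> card (c ` (N v \<inter> S)) + card ((\<lambda>x. c (w x)) ` N v)"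
        unfolding F_def by (rule card_Un_le)
      also have "\<dots> \<le> card (N v \<inter> S) + card (N v)"
        by (intro add_mono card_image_le) (auto simp: finite_neighborhood)
      also have "\<dots> \<le> d + D" using v assms(2) psubset.prems(1) by (intro add_mono) auto
      finally have "card F < D + d + 1" by simp
      moreover have "finite F" by (auto simp: F_def finite_neighborhood)
      ultimately obtain a where a: "a < D + d + 1" "a \<notin> F" using ex_color_less by metis
      define c' where "c' = c(v := a)"
      have "c' ` S \<subseteq> {..<D + d + 1}" using c(1) a(1) by (auto simp: c'_def S'_def)
      moreover have "c' x \<noteq> c' y" if "x \<in> S" "y \<in> N x \<inter> S" for x y
      proof -
        have "x \<noteq> y" using that neighborhood_irrefl by auto
        moreover have "c x \<noteq> c y" if "x \<noteq> v" "y \<noteq> v"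
          using c(2) \<open>x \<in> S\<close> \<open>y \<in> N x \<inter> S\<close> that unfolding pcf_on_def S'_def by auto
        moreover have "c u \<noteq> a" if "u \<in> N v" "u \<in> S" for u using a(2) that by (auto simp: F_def)
        ultimately show ?thesis
          using that neighborhood_sym unfolding c'_def by (auto split: if_splits)
      qed
      moreover have "uniquely_colored c' (N x \<inter> S)" if x: "x \<in> V" "N x \<inter> S \<noteq> {}" for x
      proof (cases "v \<in> N x")
        case False
        then have eq: "N x \<inter> S = N x \<inter> S'" by (auto simp: S'_def)
        with x c(2) have "uniquely_colored c (N x \<inter> S)" unfolding pcf_on_def by auto
        moreover have "uniquely_colored c' (N x \<inter> S) = uniquely_colored c (N x \<inter> S)"
          using False by (intro uniquely_colored_cong) (auto simp: c'_def)
        ultimately show ?thesis by simp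
      next
        case True
        show ?thesis
        proof (cases "N x \<inter> S' = {}")
          case True
          \<comment> \<open>\<open>v\<close> is the first neighbor of \<open>x\<close> to be colored
            and becomes its witness.\<close>
          then have "N x \<inter> S = {v}" using \<open>v \<in> N x\<close> v by (auto simp: S'_def)
          then show ?thesis by (simp add: uniquely_colored_def)
        next
          case False
          note w = w[OF x(1) False]
          have "c (w x) \<noteq> a" using a(2) True neighborhood_sym by (auto simp: F_def)
          moreover have "w x \<noteq> v" using w by (auto simp: S'_def)
          ultimately show ?thesis using w unfolding uniquely_colored_def
            by (intro bexI[of _ "w x"]) (auto simp: c'_def S'_def)
        qed
      qed
      ultimately show ?thesis unfolding pcf_on_def by blast
    qed
  qed
qed

lemma pcf_chromatic_number_greedy:
  assumes "\<And>T. T \<subseteq> V \<Longrightarrow> T \<noteq> {} \<Longrightarrow> \<exists>v\<in>T. card (N v \<inter> T) \<le> d"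
  shows "pcf_chromatic_number G \<le> max_degree G + d + 1"
  using greedy_pcf_on[OF order_refl card_neighborhood_le assms] pcf_chromatic_number_le by blast

lemma pcf_chromatic_number_le_degeneracy:
  "pcf_chromatic_number G \<le> max_degree G + degeneracy G + 1"
  by (rule pcf_chromatic_number_greedy[OF degeneracy_subset])

lemma pcf_chromatic_number_le_max_degree: "pcf_chromatic_number G \<le> 2 * max_degree G + 1"
proof -
  have "\<exists>v\<in>T. card (N v \<inter> T) \<le> max_degree G" if "T \<subseteq> V" "T \<noteq> {}" for T
    using degeneracy_subset[OF that] degeneracy_le_max_degree le_trans by blast
  from pcf_chromatic_number_greedy[OF this] show ?thesis by simp
qed

text \<open>A set all of whose members have full degree \<open>d + 1\<close> inside it is closed under adjacency.\<close>

lemma connected_low_degree_vertex: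
  assumes conn: "Digraph_Component.connected (with_proj G)"
    and r: "r \<in> V" and S: "r \<notin> S \<or> card (N r) \<le> d" "S \<subseteq> V"
    and D: "\<And>x. x \<in> V \<Longrightarrow> card (N x) \<le> Suc d"
    and T: "T \<subseteq> S" "T \<noteq> {}"
  shows "\<exists>v\<in>T. card (N v \<inter> T) \<le> d"
proof (rule ccontr)
  assume contr: "\<not> ?thesis"
  have cl: "N v \<subseteq> T \<and> card (N v) = Suc d" if "v \<in> T" for v
  proof -
    have "card (N v) \<le> Suc d" "Suc d \<le> card (N v \<inter> T)"
      using contr that D S T by (auto simp: not_le Suc_le_eq)
    moreover from this have "N v \<inter> T = N v" by (intro card_seteq) (auto simp: finite_neighborhood)
    ultimately show ?thesis by auto
  qed
  then have "T = V" using connected_closed_eq[OF conn] S T by auto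
  \<comment> \<open>\<open>T\<close> contains \<open>r\<close>, which contradicts
    \<open>r \<notin> S\<close>, or else \<open>card (N r) = Suc d\<close> contradicts
    \<open>card (N r) \<le> d\<close>.\<close>
  then show False using r cl T S by auto
qed

section \<open>Maximum degree 3\<close>

lemma pcf_chromatic_number_le_6_cubic:
  assumes conn: "Digraph_Component.connected (with_proj G)"
    and cubic: "\<And>x. x \<in> V \<Longrightarrow> card (N x) = 3" and r: "r \<in> V"
  shows "pcf_chromatic_number G \<le> 6"
proof -
  define S where "S = V - {r}"
  \<comment> \<open>With \<open>r\<close> removed, no vertex set can keep full degree 3 throughout,
    so the greedy bound is 3 + 2 + 1 = 6.\<close>
  have "\<exists>v\<in>T. card (N v \<inter> T) \<le> 2" if "T \<subseteq> S" "T \<noteq> {}" for T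
    using connected_low_degree_vertex[OF conn r, of S 2 T] that cubic by (auto simp: S_def)
  then obtain c where c: "c ` S \<subseteq> {..<6}" "pcf_on S c"
    using greedy_pcf_on[of S 3 2] cubic by (auto simp: S_def)
  have NS: "N x \<subseteq> S \<longleftrightarrow> x \<notin> N r" for x
    using neighborhood_subset neighborhood_sym by (auto simp: S_def)
  have rr: "r \<notin> N r" by (rule neighborhood_irrefl)
  have NrS: "N r \<subseteq> S" using NS rr by simp
  have proper: "c x \<noteq> c y" if "x \<in> S" "y \<in> N x" "y \<in> S" for x y
    using c(2) that unfolding pcf_on_def by auto
  have unique: "uniquely_colored c (N x)" if "x \<in> V" "x \<notin> N r" for x
  proof -
    have "N x \<inter> S = N x" using NS that by auto
    moreover have "N x \<noteq> {}" using cubic[OF that(1)] by auto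
    ultimately show ?thesis using c(2) that unfolding pcf_on_def by metis
  qed
  \<comment> \<open>If the two neighbors of \<open>x\<close> other than \<open>r\<close> share the
    color \<open>a\<close>, then giving \<open>a\<close> to \<open>r\<close> would make
    \<open>N x\<close> monochromatic. So \<open>M\<close> together with the colors on
    \<open>N r\<close> is exactly what \<open>r\<close> has to avoid.\<close>
  define M where "M = {a. \<exists>x\<in>N r. c ` (N x - {r}) = {a}}"
  show ?thesis
  proof (cases "{..<6} \<subseteq> c ` N r \<union> M")
    case False
    then obtain a where a: "a < 6" "a \<notin> c ` N r" "a \<notin> M" by auto
    define c' where "c' = c(r := a)"
    have "pcf_on V c'" unfolding pcf_on_def
    proof (intro conjI ballI impI)
      fix x y assume xy: "x \<in> V" "y \<in> N x \<inter> V"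
      then have "x \<noteq> y" using neighborhood_irrefl by auto
      then show "c' x \<noteq> c' y"
        using xy a(2) proper[of x y] neighborhood_sym[of x y] by (auto simp: c'_def S_def)
    next
      fix x assume x: "x \<in> V"
      have NV: "N x \<inter> V = N x" using neighborhood_subset by auto
      show "uniquely_colored c' (N x \<inter> V)"
      proof (cases "x \<in> N r")
        case False
        then have "r \<notin> N x" using neighborhood_sym by auto
        then have "uniquely_colored c' (N x) = uniquely_colored c (N x)"
          by (intro uniquely_colored_cong) (auto simp: c'_def)
        then show ?thesis using unique[OF x False] NV by simp
      next
        case True
        then have rx: "r \<in> N x" using neighborhood_sym by auto
        have "c ` (N x - {r}) \<noteq> {a}" using a(3) True by (auto simp: M_def)
        moreover have "\<not> N x \<subseteq> {r}" using cubic[OF x] card_mono[of "{r}" "N x"] by auto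
        then have "N x - {r} \<noteq> {}" by auto
        ultimately obtain p where p: "p \<in> N x - {r}" "c p \<noteq> a" by auto
        have "uniquely_colored c' (N x)"
          by (rule uniquely_colored_card3[OF cubic[OF x], of r p]) (use p rx in \<open>auto simp: c'_def\<close>)
        then show ?thesis using NV by simp
      qed
    qed
    moreover have "c' ` V \<subseteq> {..<6}" using c(1) a(1) by (auto simp: c'_def S_def)
    ultimately show ?thesis by (rule pcf_chromatic_number_le)
  next
    case blocked: True
    \<comment> \<open>\<open>b x\<close> is the common color of the neighbors of \<open>x\<close>
      other than \<open>r\<close>. It is meaningful for \<open>x\<close> in \<open>R\<close>, which
      turns out to be all of \<open>N r\<close>.\<close>
    define b where "b x = (SOME a. c ` (N x - {r}) = {a})" for x
    define R where "R = {x \<in> N r. \<exists>a. c ` (N x - {r}) = {a}}"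
    have bR: "c ` (N x - {r}) = {b x}" if "x \<in> R" for x
      using that someI_ex[of "\<lambda>a. c ` (N x - {r}) = {a}"] by (auto simp: R_def b_def)
    have M: "M = b ` R"
    proof -
      have "a \<in> b ` R" if "a \<in> M" for a
      proof -
        obtain x where x: "x \<in> N r" "c ` (N x - {r}) = {a}" using \<open>a \<in> M\<close> by (auto simp: M_def)
        then have "x \<in> R" by (auto simp: R_def)
        with bR[OF this] x show ?thesis by auto
      qed
      moreover have "b x \<in> M" if "x \<in> R" for x using bR[OF that] that by (auto simp: M_def R_def)
      ultimately show ?thesis by auto
    qed
    have fin: "finite (N r)" "finite R" by (auto simp: R_def finite_neighborhood)
    have "R \<subseteq> N r" by (auto simp: R_def)
    have card: "card (c ` N r) \<le> 3" "card M \<le> card R" "card R \<le> 3"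
      using card_image_le[OF fin(1), of c] card_image_le[OF fin(2), of b]
        card_mono[OF fin(1) \<open>R \<subseteq> N r\<close>] cubic[OF r] M by auto
    \<comment> \<open>Two sets of at most three colors each cover six colors, so they are disjoint
      and both have size 3. This makes \<open>c\<close> injective on \<open>N r\<close> and forces
      \<open>R = N r\<close>.\<close>
    have "6 \<le> card (c ` N r \<union> M)" using card_mono[OF _ blocked] fin M by auto
    also have "\<dots> + card (c ` N r \<inter> M) = card (c ` N r) + card M"
      using card_Un_Int[of "c ` N r" M] fin M by auto
    finally have "6 + card (c ` N r \<inter> M) \<le> card (c ` N r) + card M" by simp
    with card have eqs: "card (c ` N r \<inter> M) = 0" "card (c ` N r) = 3" "card R = 3" by linarith+
    have disj: "c ` N r \<inter> M = {}" using eqs(1) fin by auto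
    have inj: "inj_on c (N r)" using eqs(2) cubic[OF r] fin by (intro eq_card_imp_inj_on) auto
    have "R = N r" using card_seteq[OF fin(1) \<open>R \<subseteq> N r\<close>] eqs(3) cubic[OF r] by auto
    then have b: "c y = b x" if "x \<in> N r" "y \<in> N x" "y \<noteq> r" for x y using bR[of x] that by blast
    have bneq: "b x \<noteq> c y" if "x \<in> N r" "y \<in> N r" for x y
      using disj M \<open>R = N r\<close> that by blast
    \<comment> \<open>An edge inside \<open>N r\<close> would put the color \<open>c y = b x\<close>
      into both of the disjoint sets.\<close>
    have indep: "y \<notin> N x" if "x \<in> N r" "y \<in> N r" for x y
      using b[OF that(1), of y] bneq[OF that] rr that(2) by auto
    obtain u where u: "u \<in> N r" using cubic[OF r] by force
    then have "u \<in> V" "u \<in> S" "u \<noteq> r" "r \<in> N u"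
      using NrS neighborhood_sym[of u r] by (auto simp: S_def)
    have "\<exists>q. q \<in> N x \<and> q \<noteq> u" if "x \<in> N u" for x
    proof -
      have "card (N x) = 3" using that cubic neighborhood_subset by blast
      then have "\<not> N x \<subseteq> {u}" using card_mono[of "{u}" "N x"] by auto
      then show ?thesis by auto
    qed
    then obtain q where q: "\<And>x. x \<in> N u \<Longrightarrow> q x \<in> N x \<and> q x \<noteq> u" by metis
    \<comment> \<open>For \<open>x \<noteq> r\<close> adjacent to \<open>u\<close>, avoiding \<open>c (q x)\<close> keeps \<open>N x\<close> from becoming monochromatic.\<close>
    define F where "F = {c u, b u} \<union> (\<lambda>x. c (q x)) ` (N u - {r})"
    have "card (N u - {r}) = 2"
      using cubic[OF \<open>u \<in> V\<close>] \<open>r \<in> N u\<close> finite_neighborhood[of u] by (simp add: card_Diff_singleton)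
    then have "card ((\<lambda>x. c (q x)) ` (N u - {r})) \<le> 2"
      using card_image_le[of "N u - {r}" "\<lambda>x. c (q x)"] finite_neighborhood[of u] by auto
    moreover have "card {c u, b u} \<le> 2" by (auto simp: card_insert_if)
    ultimately have "card F < 6" using card_Un_le[of "{c u, b u}" "(\<lambda>x. c (q x)) ` (N u - {r})"]
      unfolding F_def by linarith
    moreover have "finite F" by (auto simp: F_def finite_neighborhood)
    ultimately obtain a where a: "a < 6" "a \<notin> F" using ex_color_less by metis
    \<comment> \<open>\<open>r\<close> takes over the color of \<open>u\<close>, which no other
      neighbor of \<open>r\<close> has. The new color of \<open>u\<close> differs from that of
      \<open>r\<close> and from \<open>b u\<close>, the color of the remaining neighbors of
      \<open>u\<close>.\<close>
    define c' where "c' = c(u := a, r := c u)"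
    have c': "c' r = c u" "c' u = a" "\<And>x. x \<noteq> r \<Longrightarrow> x \<noteq> u \<Longrightarrow> c' x = c x"
      using \<open>u \<noteq> r\<close> by (auto simp: c'_def)
    have au: "a \<noteq> c u" "a \<noteq> b u" using a(2) by (auto simp: F_def)
    have proper_r: "c' r \<noteq> c' y" if "y \<in> N r" for y
    proof (cases "y = u")
      case False
      then have "c u \<noteq> c y" using inj u that by (auto dest: inj_onD)
      moreover have "y \<noteq> r" using that rr by auto
      ultimately show ?thesis using c' False by simp
    qed (use au c' in simp)
    have proper_u: "c' u \<noteq> c' y" if "y \<in> N u" for y
    proof (cases "y = r")
      case False
      moreover have "y \<noteq> u" using that neighborhood_irrefl by auto
      ultimately show ?thesis using b[OF u that] au c' by simp
    qed (use au c' in simp)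
    have "pcf_on V c'" unfolding pcf_on_def
    proof (intro conjI ballI impI)
      fix x y assume xy: "x \<in> V" "y \<in> N x \<inter> V"
      then have "x \<in> N y" using neighborhood_sym[of x y] by auto
      consider "x = r" | "x = u" | "y = r" | "y = u" | "x \<notin> {r, u}" "y \<notin> {r, u}" by blast
      then show "c' x \<noteq> c' y"
      proof cases
        case 1 then show ?thesis using proper_r xy by auto
      next
        case 2 then show ?thesis using proper_u xy by auto
      next
        case 3 then show ?thesis using proper_r[of x] \<open>x \<in> N y\<close> by auto
      next
        case 4 then show ?thesis using proper_u[of x] \<open>x \<in> N y\<close> by auto
      next
        case 5 then show ?thesis using proper[of x y] xy by (auto simp: c' S_def)
      qed
    next
      fix x assume x: "x \<in> V"
      have NV: "N x \<inter> V = N x" using neighborhood_subset by auto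
      \<comment> \<open>Two colors in each neighborhood suffice by
        \<open>uniquely_colored_card3\<close>. At \<open>r\<close>, the neighbors other than
        \<open>u\<close> still have distinct colors. At a neighbor \<open>x\<close> of
        \<open>r\<close>, the color \<open>c u\<close> now on \<open>r\<close> differs from
        \<open>b x\<close>. At other neighbors of \<open>u\<close>, \<open>q x\<close> keeps a color
        different from \<open>a\<close>. The remaining neighborhoods are unchanged.\<close>
      have two: "\<exists>p\<in>N x. \<exists>q\<in>N x. c' p \<noteq> c' q"
      proof -
        consider "x = r" | "x \<in> N r" | "x \<in> N u" "x \<noteq> r" "x \<notin> N r" | "x \<notin> N r" "x \<notin> N u" by blast
        then show ?thesis
        proof cases
          case 1
          have "card (N r - {u}) = 2"
            using cubic[OF r] u fin by (simp add: card_Diff_singleton)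
          then obtain p1 p2 where p: "N r - {u} = {p1, p2}" "p1 \<noteq> p2" by (auto simp: card_2_iff)
          then have "p1 \<in> N r - {u}" "p2 \<in> N r - {u}" by auto
          moreover from this have "c p1 \<noteq> c p2" using inj p(2) by (auto dest: inj_onD)
          moreover from calculation have "p1 \<noteq> r" "p2 \<noteq> r" using rr by auto
          ultimately have "c' p1 \<noteq> c' p2" "p1 \<in> N x" "p2 \<in> N x" using 1 by (auto simp: c')
          then show ?thesis by blast
        next
          case 2
          then have rx: "r \<in> N x" using neighborhood_sym by auto
          have "\<not> N x \<subseteq> {r}" using cubic[OF x] card_mono[of "{r}" "N x"] by auto
          then obtain p where p: "p \<in> N x" "p \<noteq> r" by auto
          have "p \<noteq> u" using indep[OF 2 u] p by auto
          then have "c' p = b x" using p b[OF 2] by (auto simp: c')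
          then show ?thesis using bneq[OF 2 u] rx p c'(1) by metis
        next
          case 3
          then have "q x \<noteq> r" using q neighborhood_sym by metis
          then have "c' (q x) = c (q x)" using q 3 by (auto simp: c')
          moreover have "c (q x) \<noteq> a" using a(2) 3 by (auto simp: F_def)
          moreover have "u \<in> N x" "q x \<in> N x" using 3 q neighborhood_sym by auto
          ultimately show ?thesis using c'(2) by metis
        next
          case 4
          obtain p q where "p \<in> N x" "q \<in> N x" "c p \<noteq> c q"
            using uniquely_colored_two_colors[OF unique[OF x 4(1)]] cubic[OF x] by auto
          moreover have "r \<notin> N x" "u \<notin> N x" using 4 neighborhood_sym by auto
          ultimately show ?thesis using c'(3) by metis
        qed
      qed
      then show "uniquely_colored c' (N x \<inter> V)"
        using uniquely_colored_card3[OF cubic[OF x]] NV by metis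
    qed
    moreover have "c' ` V \<subseteq> {..<6}" using c(1) a(1) \<open>u \<in> S\<close> by (auto simp: c'_def S_def)
    ultimately show ?thesis by (rule pcf_chromatic_number_le)
  qed
qed

text \<open>A vertex of degree less than 3 makes a connected graph of maximum degree 3 2-degenerate,
  and greedy coloring then needs 3 + 2 + 1 colors. Otherwise the graph is cubic.\<close>

lemma pcf_chromatic_number_le_6:
  assumes conn: "Digraph_Component.connected (with_proj G)" and deg: "max_degree G = 3"
  shows "pcf_chromatic_number G \<le> 6"
proof (cases "\<exists>r\<in>V. card (N r) < 3")
  case True
  then obtain r where r: "r \<in> V" "card (N r) < 3" by auto
  have "\<exists>v\<in>T. card (N v \<inter> T) \<le> 2" if "T \<subseteq> V" "T \<noteq> {}" for T
    using connected_low_degree_vertex[OF conn r(1), of V 2 T] that r(2) card_neighborhood_le deg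
    by auto
  from pcf_chromatic_number_greedy[OF this] deg show ?thesis by simp
next
  case False
  then have "card (N x) = 3" if "x \<in> V" for x
    using that card_neighborhood_le[OF that] deg by force
  moreover obtain r where "r \<in> V"
    using conn by (auto simp: connected_conv)
  ultimately show ?thesis using pcf_chromatic_number_le_6_cubic[OF conn] by blast
qed

section \<open>Maximum degree at most 2\<close>

text \<open>The values of \<open>f\<close> from index \<open>n\<close> on are left free, so that a
  path is extended by the update \<open>f(n := y)\<close>.\<close>

definition path_seq :: "nat \<Rightarrow> (nat \<Rightarrow> 'a) \<Rightarrow> bool" where
  "path_seq n f \<longleftrightarrow> inj_on f {..<n} \<and> f ` {..<n} \<subseteq> V \<and> (\<forall>i. Suc i < n \<longrightarrow> f (Suc i) \<in> N (f i))"

lemma path_seq_rev: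
  assumes "path_seq n f"
  shows "path_seq n (\<lambda>i. f (n - 1 - i))"
proof -
  have "f (n - 1 - Suc i) \<in> N (f (n - 1 - i))" if "Suc i < n" for i
  proof -
    have "Suc (n - 1 - Suc i) = n - 1 - i" "Suc (n - 1 - Suc i) < n" using that by auto
    then show ?thesis using assms neighborhood_sym unfolding path_seq_def by metis
  qed
  moreover have "inj_on (\<lambda>i. f (n - 1 - i)) {..<n}"
  proof (rule inj_onI)
    fix i j assume ij: "i \<in> {..<n}" "j \<in> {..<n}" "f (n - 1 - i) = f (n - 1 - j)"
    then have "n - 1 - i = n - 1 - j"
      using assms unfolding path_seq_def by (auto dest: inj_onD)
    with ij show "i = j" by auto
  qed
  ultimately show ?thesis using assms unfolding path_seq_def by auto
qed

lemma path_seq_snoc: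
  assumes "path_seq n f" "n > 0" "y \<in> N (f (n - 1))" "y \<notin> f ` {..<n}"
  shows "path_seq (Suc n) (f(n := y))"
proof -
  have "Suc i < Suc n \<Longrightarrow> (f(n := y)) (Suc i) \<in> N ((f(n := y)) i)" for i
    using assms unfolding path_seq_def by (cases "Suc i = n") auto
  moreover have "inj_on (f(n := y)) {..<Suc n}"
    using assms unfolding path_seq_def lessThan_Suc by (auto simp: inj_on_def)
  moreover have "y \<in> V" using assms neighborhood_subset by blast
  ultimately show ?thesis using assms unfolding path_seq_def by (auto simp: lessThan_Suc)
qed

text \<open>Take a path with the most vertices. By maximality its ends have all their neighbors on
  it, and by the degree bound so do its inner vertices, hence it spans the graph. The index
  condition modulo \<open>n\<close> admits the closing edge without asserting it, which covers paths
  and cycles at once.\<close>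

lemma connected_max_degree_2_enum:
  assumes conn: "Digraph_Component.connected (with_proj G)" and deg: "max_degree G \<le> 2"
  obtains n f where "bij_betw f {..<n} V"
    "\<And>i. Suc i < n \<Longrightarrow> f (Suc i) \<in> N (f i)"
    "\<And>i j. i < n \<Longrightarrow> j < n \<Longrightarrow> f j \<in> N (f i) \<Longrightarrow> j = Suc i mod n \<or> i = Suc j mod n"
proof -
  obtain r where r: "r \<in> V" using conn by (auto simp: connected_conv)
  define P where "P n \<longleftrightarrow> (\<exists>f. path_seq n f)" for n
  have "P 1" using r unfolding P_def path_seq_def by (intro exI[of _ "\<lambda>_. r"]) (auto simp: inj_on_def)
  moreover have bound: "n \<le> card V" if Pn: "P n" for n
  proof -
    obtain f where f: "inj_on f {..<n}" "f ` {..<n} \<subseteq> V"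
      using Pn unfolding P_def path_seq_def by blast
    then show ?thesis using card_inj_on_le[OF f pair_finite_verts] by simp
  qed
  ultimately obtain n where n: "P n" "\<And>m. P m \<Longrightarrow> m \<le> n"
    using Nat.ex_has_greatest_nat[of P 1 "card V"] by auto
  have "n > 0" using n(2)[OF \<open>P 1\<close>] by simp
  obtain f where f: "path_seq n f" using n by (auto simp: P_def)
  have inj: "i = j" if "f i = f j" "i < n" "j < n" for i j
    using f that unfolding path_seq_def by (auto dest: inj_onD)
  have step: "f (Suc i) \<in> N (f i)" if "Suc i < n" for i using f that unfolding path_seq_def by auto
  have last: "N (g (n - 1)) \<subseteq> g ` {..<n}" if "path_seq n g" for g
  proof
    fix y assume "y \<in> N (g (n - 1))"
    then have "y \<notin> g ` {..<n} \<Longrightarrow> P (Suc n)"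
      using path_seq_snoc[OF that \<open>n > 0\<close>] unfolding P_def by blast
    then show "y \<in> g ` {..<n}" using n(2) by fastforce
  qed
  have inner: "N (f i) = {f (i - 1), f (Suc i)}" if "0 < i" "Suc i < n" for i
  proof (rule card_seteq[symmetric])
    have "f i \<in> V" using f that unfolding path_seq_def by auto
    then have "card (N (f i)) \<le> 2" using card_neighborhood_le deg le_trans by blast
    moreover have "i - 1 < n" using that by linarith
    then have "f (i - 1) \<noteq> f (Suc i)" using inj[of "i - 1" "Suc i"] that by auto
    ultimately show "card (N (f i)) \<le> card {f (i - 1), f (Suc i)}" by simp
    show "{f (i - 1), f (Suc i)} \<subseteq> N (f i)"
      using step[of i] step[of "i - 1"] that neighborhood_sym[of "f i" "f (i - 1)"] by auto
  qed (rule finite_neighborhood)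
  have img: "N (f i) \<subseteq> f ` {..<n}" if i: "i < n" for i
  proof -
    consider "i = 0" | "i = n - 1" | "0 < i" "Suc i < n" using i by linarith
    then show ?thesis
    proof cases
      case 1
      \<comment> \<open>The first vertex is the last one of the reversed path.\<close>
      have "f 0 = f (n - 1 - (n - 1))" by simp
      then show ?thesis using last[OF path_seq_rev[OF f]] 1 by fastforce
    next
      case 2 then show ?thesis using last[OF f] by simp
    next
      case 3 then show ?thesis using inner by auto
    qed
  qed
  have "f ` {..<n} = V"
    by (rule connected_closed_eq[OF conn]) (use f img \<open>n > 0\<close> in \<open>auto simp: path_seq_def\<close>)
  then have bij: "bij_betw f {..<n} V" using f by (auto simp: bij_betw_def path_seq_def)
  have adj: "j = Suc i \<or> i = Suc j" if "0 < i" "Suc i < n" "j < n" "f j \<in> N (f i)" for i j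
    using inner[OF that(1,2)] that inj[of j "i - 1"] inj[of j "Suc i"] by auto
  have "j = Suc i mod n \<or> i = Suc j mod n" if ij: "i < n" "j < n" "f j \<in> N (f i)" for i j
  proof -
    have "i \<noteq> j" using neighborhood_irrefl ij by auto
    moreover have "f i \<in> N (f j)" using ij neighborhood_sym by auto
    \<comment> \<open>An edge with an inner end joins consecutive indices; any other edge joins the
      two ends of the path.\<close>
    moreover have "(i = 0 \<or> i = n - 1) \<and> (j = 0 \<or> j = n - 1) \<or> j = Suc i \<or> i = Suc j"
      using adj[of i j] adj[of j i] ij calculation by fastforce
    ultimately show ?thesis using ij by auto
  qed
  with that[OF bij step] show thesis by blast
qed

text \<open>A proper coloring of the square is injective on every neighborhood, so each color there
  is unique. Colors are given on indices to allow arithmetic definitions.\<close>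

lemma pcf_chromatic_number_le_square_coloring:
  assumes f: "bij_betw f {..<n} V"
    and adj: "\<And>i j. i < n \<Longrightarrow> j < n \<Longrightarrow> f j \<in> N (f i) \<Longrightarrow> c i \<noteq> c j"
    and sq: "\<And>i j k. i < n \<Longrightarrow> j < n \<Longrightarrow> k < n \<Longrightarrow> j \<noteq> k \<Longrightarrow> f j \<in> N (f i) \<Longrightarrow> f k \<in> N (f i)
        \<Longrightarrow> c j \<noteq> c k"
    and m: "\<And>i. i < n \<Longrightarrow> c i < m"
  shows "pcf_chromatic_number G \<le> m"
proof (rule pcf_chromatic_number_le)
  define d where "d x = c (the_inv_into {..<n} f x)" for x
  have d: "d (f i) = c i" if "i < n" for i
    using that f unfolding d_def bij_betw_def by (simp add: the_inv_into_f_f)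
  have ex: "\<exists>i<n. x = f i" if "x \<in> V" for x using f that unfolding bij_betw_def by auto
  show "d ` V \<subseteq> {..<m}" using ex d m by fastforce
  show "pcf_on V d" unfolding pcf_on_def
  proof (intro conjI ballI impI)
    fix x y assume "x \<in> V" "y \<in> N x \<inter> V"
    then show "d x \<noteq> d y" using ex[of x] ex[of y] adj d by auto
  next
    fix x assume x: "x \<in> V" and ne: "N x \<inter> V \<noteq> {}"
    have "inj_on d (N x \<inter> V)"
    proof (rule inj_onI, rule ccontr)
      fix y z assume "y \<in> N x \<inter> V" "z \<in> N x \<inter> V" "d y = d z" "y \<noteq> z"
      with ex[OF x] ex[of y] ex[of z] sq d show False by (metis Int_iff)
    qed
    then show "uniquely_colored d (N x \<inter> V)" using ne by (rule uniquely_colored_inj_on)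
  qed
qed

section \<open>Injective colorings and the extremal graphs \<open>K_2\<close> and
  \<open>C_5\<close>\<close>

lemma pcf_chromatic_number_le_card: "pcf_chromatic_number G \<le> card V"
proof -
  obtain c :: "'a \<Rightarrow> nat" where c: "bij_betw c V {0..<card V}"
    using ex_bij_betw_finite_nat[OF pair_finite_verts] by blast
  then have inj: "inj_on c V" by (rule bij_betw_imp_inj_on)
  have "pcf_on V c" unfolding pcf_on_def
  proof (intro conjI ballI impI)
    fix x y assume "x \<in> V" "y \<in> N x \<inter> V"
    then show "c x \<noteq> c y" using inj neighborhood_irrefl by (auto dest: inj_onD)
  qed (auto intro!: uniquely_colored_inj_on inj_on_subset[OF inj])
  moreover have "c ` V \<subseteq> {..<card V}" using c by (auto simp: bij_betw_def)
  ultimately show ?thesis by (rule pcf_chromatic_number_le)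
qed

lemma pcf_chromatic_number_eq_card:
  assumes "\<And>(c :: 'a \<Rightarrow> nat) k. pcf_coloring G k c \<Longrightarrow> inj_on c V"
  shows "pcf_chromatic_number G = card V"
proof (rule antisym[OF pcf_chromatic_number_le_card])
  obtain c :: "'a \<Rightarrow> nat" where c: "pcf_coloring G (pcf_chromatic_number G) c"
    by (rule pcf_chromatic_number_coloring)
  then show "card V \<le> pcf_chromatic_number G"
    using card_image[OF assms[OF c]] by (auto simp: pcf_coloring_def)
qed

lemma max_degree_vertex:
  assumes "V \<noteq> {}"
  obtains x where "x \<in> V" "card (N x) = max_degree G"
proof -
  have "max_degree G \<in> (\<lambda>x. card (N x)) ` V"
    unfolding max_degree_def out_degree_with_proj by (rule Max_in) (use assms pair_finite_verts in auto)
  with that show thesis by auto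
qed

lemma degeneracy_ge:
  assumes "V \<noteq> {}" "\<And>x. x \<in> V \<Longrightarrow> d \<le> card (N x)"
  shows "d \<le> degeneracy G"
proof -
  have "N x \<inter> V = N x" for x using neighborhood_subset by auto
  with degeneracy_subset[OF order_refl assms(1)] assms(2) show ?thesis by fastforce
qed

text \<open>The only neighbor \<open>y\<close> of \<open>x\<close> has no neighbor besides
  \<open>x\<close>, so \<open>{x, y}\<close> is closed under adjacency.\<close>

lemma connected_max_degree_1:
  assumes conn: "Digraph_Component.connected (with_proj G)" and deg: "max_degree G = 1"
  shows "complete_digraph 2 (with_proj G)"
proof -
  have "V \<noteq> {}" using conn by (auto simp: connected_conv)
  then obtain x where x: "x \<in> V" "card (N x) = 1" using max_degree_vertex deg by metis
  then obtain y where y: "N x = {y}" by (auto simp: card_1_singleton_iff)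
  then have "y \<in> V" "x \<in> N y" using neighborhood_subset neighborhood_sym[of y x] by auto
  have "{x} = N y"
    using \<open>x \<in> N y\<close> card_neighborhood_le[OF \<open>y \<in> V\<close>] deg
    by (intro card_seteq) (auto simp: finite_neighborhood)
  then have V: "V = {x, y}"
    using connected_closed_eq[OF conn, of "{x, y}"] x y \<open>y \<in> V\<close> by auto
  have "x \<noteq> y" using y neighborhood_irrefl by auto
  have N: "(u, v) \<in> parcs G \<longleftrightarrow> v \<in> N u" for u v by (simp add: neighborhood_def)
  have "parcs G = {(u, v). (u, v) \<in> V \<times> V \<and> u \<noteq> v}"
  proof (intro set_eqI, clarify)
    fix u v
    show "(u, v) \<in> parcs G \<longleftrightarrow> (u, v) \<in> {(u, v). (u, v) \<in> V \<times> V \<and> u \<noteq> v}"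
    proof (cases "u = x \<or> u = y")
      case True
      then show ?thesis using V y \<open>{x} = N y\<close>[symmetric] N \<open>x \<noteq> y\<close> by auto
    next
      case False
      then show ?thesis using V wellformed'(1)[of u v] by auto
    qed
  qed
  with V \<open>x \<noteq> y\<close> show ?thesis unfolding complete_digraph_pair_def by auto
qed

lemma complete_digraph_2:
  assumes "complete_digraph 2 (with_proj G)"
  shows "max_degree G = 1" "pcf_chromatic_number G = 2"
proof -
  have card: "card V = 2" and arcs: "parcs G = {(u, v). (u, v) \<in> V \<times> V \<and> u \<noteq> v}"
    using assms by (auto simp: complete_digraph_pair_def)
  have "N x = V - {x}" if "x \<in> V" for x using that arcs by (auto simp: neighborhood_def)
  then have "card (N x) = 1" if "x \<in> V" for x using that card by simp
  moreover have "V \<noteq> {}" using card by auto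
  ultimately show "max_degree G = 1" using max_degree_vertex by metis
  have "inj_on c V" if "pcf_coloring G k c" for c :: "'a \<Rightarrow> nat" and k
  proof (rule inj_onI, rule ccontr)
    fix x y assume "x \<in> V" "y \<in> V" "c x = c y" "x \<noteq> y"
    then show False using that arcs by (auto simp: pcf_coloring_def proper_coloring_def)
  qed
  then show "pcf_chromatic_number G = 2" using pcf_chromatic_number_eq_card card by metis
qed

text \<open>An arc of a pair digraph is the pair of its ends, so the vertex map determines the arc
  map.\<close>

lemma digraph_iso_pair_iff:
  "digraph_iso (with_proj G) (with_proj H) \<longleftrightarrow>
    (\<exists>h. bij_betw h V (pverts H) \<and> parcs H = map_prod h h ` parcs G)"
proof
  assume "digraph_iso (with_proj G) (with_proj H)"
  then obtain f where f: "digraph_isomorphism f" "with_proj H = app_iso f (with_proj G)"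
    unfolding digraph_iso_def by auto
  have "iso_tail f = fst" "iso_head f = snd" using f(2)
    by (metis app_iso_simps(3) with_proj_simps(4), metis app_iso_simps(4) with_proj_simps(5))
  then have "\<forall>a\<in>parcs G. iso_arcs f a = map_prod (iso_verts f) (iso_verts f) a"
    using f(1) by (auto simp: digraph_isomorphism_def prod_eq_iff)
  moreover have "parcs H = iso_arcs f ` parcs G" "pverts H = iso_verts f ` V" using f(2)
    by (metis app_iso_simps(2) with_proj_simps(2), metis app_iso_simps(1) with_proj_simps(1))
  ultimately show "\<exists>h. bij_betw h V (pverts H) \<and> parcs H = map_prod h h ` parcs G"
    using f(1) by (intro exI[of _ "iso_verts f"]) (auto simp: digraph_isomorphism_def bij_betw_def)
next
  assume "\<exists>h. bij_betw h V (pverts H) \<and> parcs H = map_prod h h ` parcs G"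
  then obtain h where h: "bij_betw h V (pverts H)" "parcs H = map_prod h h ` parcs G" by auto
  define f where "f = \<lparr>iso_verts = h, iso_arcs = map_prod h h, iso_head = snd, iso_tail = fst\<rparr>"
  have "wf_digraph (with_proj G)" by unfold_locales
  moreover have "inj_on (map_prod h h) (parcs G)"
    using h(1) wellformed' by (auto simp: bij_betw_def inj_on_def)
  ultimately have "digraph_isomorphism f"
    using h by (auto simp: digraph_isomorphism_def f_def bij_betw_def)
  moreover have "with_proj H = app_iso f (with_proj G)"
    using h by (auto simp: app_iso_def f_def bij_betw_def with_proj_def)
  ultimately show "digraph_iso (with_proj G) (with_proj H)" unfolding digraph_iso_def by blast
qed

text \<open>Two nonadjacent vertices of \<open>C_5\<close> are the entire neighborhood of a common
  neighbor, so a PCF coloring separates them too. All five colors must therefore differ.\<close>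

lemma digraph_iso_cycle_5:
  assumes "digraph_iso (with_proj G) (with_proj (cycle_graph 5))"
  shows "max_degree G = 2" "degeneracy G = 2" "pcf_chromatic_number G = 5"
proof -
  let ?adj = "\<lambda>i j :: nat. j = Suc i mod 5 \<or> i = Suc j mod 5"
  obtain h where h: "bij_betw h V {..<5}" "parcs (cycle_graph 5) = map_prod h h ` parcs G"
    using assms unfolding digraph_iso_pair_iff by (auto simp: cycle_graph_def)
  then have inj: "inj_on h V" and im: "h ` V = {..<5}" by (auto simp: bij_betw_def)
  have adj: "y \<in> N x \<longleftrightarrow> ?adj (h x) (h y)" if "x \<in> V" "y \<in> V" for x y
  proof -
    have "y \<in> N x \<longleftrightarrow> (h x, h y) \<in> map_prod h h ` parcs G"
    proof
      assume "(h x, h y) \<in> map_prod h h ` parcs G"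
      then obtain u v where "(u, v) \<in> parcs G" "h x = h u" "h y = h v" by auto
      moreover from this have "x = u" "y = v" using that inj wellformed' by (auto dest: inj_onD)
      ultimately show "y \<in> N x" by (simp add: neighborhood_def)
    qed (auto simp: neighborhood_def)
    also have "\<dots> \<longleftrightarrow> ?adj (h x) (h y)"
      using that im unfolding h(2)[symmetric] cycle_graph_def by auto
    finally show ?thesis .
  qed
  have less5: "i < 5 \<longleftrightarrow> i = 0 \<or> i = 1 \<or> i = 2 \<or> i = 3 \<or> i = (4 :: nat)" for i by auto
  have hN: "h ` N x = {j. j < 5 \<and> ?adj (h x) j}" if "x \<in> V" for x
  proof
    show "h ` N x \<subseteq> {j. j < 5 \<and> ?adj (h x) j}"
      using adj[OF that] neighborhood_subset[of x] im by auto
    show "{j. j < 5 \<and> ?adj (h x) j} \<subseteq> h ` N x"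
    proof
      fix j assume j: "j \<in> {j. j < 5 \<and> ?adj (h x) j}"
      then have "j \<in> h ` V" using im by auto
      then obtain y where y: "y \<in> V" "j = h y" by auto
      then have "y \<in> N x" using j adj[OF that y(1)] by simp
      with y show "j \<in> h ` N x" by simp
    qed
  qed
  have two: "card {j. j < 5 \<and> ?adj i j} = 2" if "i < 5" for i
  proof -
    \<comment> \<open>\<open>i + 4\<close> is the predecessor of \<open>i\<close> modulo 5, written
      without subtraction.\<close>
    have "{j. j < 5 \<and> ?adj i j} = {Suc i mod 5, (i + 4) mod 5}"
      using that unfolding less5 by (elim disjE; hypsubst; auto)
    moreover have "Suc i mod 5 \<noteq> (i + 4) mod 5" using that unfolding less5 by auto
    ultimately show ?thesis by simp
  qed
  have deg: "card (N x) = 2" if "x \<in> V" for x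
  proof -
    have "card (N x) = card (h ` N x)"
      using inj_on_subset[OF inj neighborhood_subset] by (simp add: card_image)
    also have "\<dots> = 2" using hN[OF that] two[of "h x"] im that by auto
    finally show ?thesis .
  qed
  have "(0 :: nat) \<in> h ` V" using im by simp
  then have ne: "V \<noteq> {}" by auto
  show max: "max_degree G = 2" using max_degree_vertex[OF ne] deg by metis
  show "degeneracy G = 2"
    using degeneracy_ge[OF ne, of 2] deg degeneracy_le_max_degree max by auto
  have "inj_on c V" if c: "pcf_coloring G k c" for c :: "'a \<Rightarrow> nat" and k
  proof (rule inj_onI, rule ccontr)
    fix x y assume xy: "x \<in> V" "y \<in> V" "c x = c y" "x \<noteq> y"
    then have "y \<notin> N x" using c by (auto simp: pcf_coloring_def proper_coloring_def neighborhood_def)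
    then have nadj: "\<not> ?adj (h x) (h y)" using adj xy by auto
    have "h x \<noteq> h y" "h x < 5" "h y < 5" using xy inj im by (auto dest: inj_onD)
    then have "h y = Suc (Suc (h x) mod 5) mod 5 \<or> h x = Suc (Suc (h y) mod 5) mod 5"
      using nadj unfolding less5 by (elim disjE) simp_all
    then obtain i where i: "i < 5" "?adj i (h x)" "?adj i (h y)"
      by (metis mod_less_divisor zero_less_numeral)
    then have "i \<in> h ` V" using im by auto
    then obtain z where z: "z \<in> V" "x \<in> N z" "y \<in> N z" using adj xy i by auto
    have "{x, y} = N z" using z deg[OF z(1)] xy by (intro card_seteq) (auto simp: finite_neighborhood)
    moreover have "uniquely_colored c (N z)"
      using c z unfolding pcf_coloring_def conflict_free_coloring_def uniquely_colored_iff_card by blast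
    ultimately have "uniquely_colored c {x, y}" by simp
    then show False using xy unfolding uniquely_colored_def by auto
  qed
  then have "pcf_chromatic_number G = card V" by (rule pcf_chromatic_number_eq_card)
  also have "\<dots> = 5" using bij_betw_same_card[OF h(1)] by simp
  finally show "pcf_chromatic_number G = 5" .
qed

end

text \<open>Indices at cyclic distance 1 or 2 get different colors. The value 5 is exceptional
  because the square of \<open>C_5\<close> is complete.\<close>

lemma cycle_square_4_coloring:
  fixes n :: nat
  assumes "n \<ge> 3" "n \<noteq> 5"
  obtains c :: "nat \<Rightarrow> nat" where "\<And>i. c i < 4"
    "\<And>i. i < n \<Longrightarrow> c i \<noteq> c (Suc i mod n)"
    "\<And>i. i < n \<Longrightarrow> c i \<noteq> c (Suc (Suc i mod n) mod n)"
proof -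
  \<comment> \<open>\<open>b\<close> blocks \<open>0123\<close> followed by blocks \<open>012\<close>; there is room for them unless \<open>n\<close> is 1, 2 or 5.\<close>
  define b where "b = n mod 3"
  \<comment> \<open>After the \<open>b\<close> long blocks, \<open>i - b\<close> starts at
    \<open>3 * b\<close>, so the pattern modulo 3 resumes with color 0.\<close>
  define c where "c i = (if i < 4 * b then i mod 4 else (i - b) mod 3)" for i
  define m where "m = n div 3"
  have nm: "n = 3 * m + b" "b < 3" "m \<ge> 1" using assms by (auto simp: b_def m_def)
  then have b: "b = 0 \<or> b = 1 \<or> b = 2" "4 * b \<le> n" using assms by presburger+
  have "n - b = 3 * m" "n - b - 1 = 2 + 3 * (m - 1)" "n - b - 2 = 1 + 3 * (m - 1)"
    using nm by auto
  then have n: "(n - b) mod 3 = 0" "(n - b - 1) mod 3 = 2" "(n - b - 2) mod 3 = 1"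
    by presburger+
  have less4: "c i < 4" for i
  proof -
    have "(i - b) mod 3 < 3" "i mod 4 < 4" by simp_all
    then show ?thesis unfolding c_def by (cases "i < 4 * b") simp_all
  qed
  have mod: "Suc i mod n = (if Suc i = n then 0 else Suc i)" if "i < n" for i using that by auto
  have shift: "Suc i - b = Suc (i - b)" if "4 * b \<le> i" for i using that by simp
  have S1: "c i \<noteq> c (Suc i)" for i
  proof -
    consider "Suc i < 4 * b" | "Suc i = 4 * b" | "4 * b \<le> i" by linarith
    then show ?thesis
    proof cases
      case 2
      then have "b = 1 \<and> i = 3 \<or> b = 2 \<and> i = 7" using b(1) by auto
      then show ?thesis by (auto simp: c_def)
    qed (auto simp: c_def shift mod_Suc)
  qed
  have S2: "c i \<noteq> c (Suc (Suc i))" for i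
  proof -
    consider "Suc (Suc i) < 4 * b" | "Suc (Suc i) = 4 * b \<or> Suc i = 4 * b" | "4 * b \<le> i"
      by linarith
    then show ?thesis
    proof cases
      case 2
      then have "b = 1 \<and> (i = 2 \<or> i = 3) \<or> b = 2 \<and> (i = 6 \<or> i = 7)" using b(1) by auto
      then show ?thesis by (auto simp: c_def)
    qed (auto simp: c_def shift mod_Suc)
  qed
  have e: "c (n - 1) \<noteq> c 0" "c (n - 2) \<noteq> c 0" "c (n - 1) \<noteq> c 1"
  proof -
    have c01: "c 0 = 0" "c 1 = 1" using b(1) assms by (auto simp: c_def)
    \<comment> \<open>The final two colors are 2, 3 or 1, 2, while the sequence starts with 0, 1, so
      the pairs across the wrap-around differ.\<close>
    have "c (n - 1) \<in> {2, 3} \<and> c (n - 2) \<in> {1, 2}"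
    proof -
      consider "n = 4 * b" | "n = 4 * b + 1" | "n \<ge> 4 * b + 2" using b(2) by linarith
      then show ?thesis
      proof cases
        case 1
        then have "b = 1 \<and> n = 4 \<or> b = 2 \<and> n = 8" using b(1) assms by auto
        then show ?thesis by (auto simp: c_def)
      next
        case 2
        \<comment> \<open>The part after the long blocks has length divisible by 3, so it cannot be
          1.\<close>
        then have False using n(1) b(1) assms by auto
        then show ?thesis by simp
      next
        case 3
        then have "n - 1 - b = n - b - 1" "n - 2 - b = n - b - 2" "\<not> n - 1 < 4 * b" "\<not> n - 2 < 4 * b"
          by auto
        then show ?thesis using n by (simp add: c_def)
      qed
    qed
    with c01 show "c (n - 1) \<noteq> c 0" "c (n - 2) \<noteq> c 0" "c (n - 1) \<noteq> c 1" by auto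
  qed
  have A: "c i \<noteq> c (Suc i mod n)" if "i < n" for i
  proof (cases "Suc i = n")
    case True then have "i = n - 1" by simp
    then show ?thesis using e mod[OF that] True by simp
  qed (use S1 mod[OF that] in simp)
  have B: "c i \<noteq> c (Suc (Suc i mod n) mod n)" if i: "i < n" for i
  proof -
    consider "i = n - 1" | "i = n - 2" | "Suc (Suc i) < n" using i by linarith
    then show ?thesis
    proof cases
      case 1 then show ?thesis using e assms by simp
    next
      case 2
      then have "Suc i mod n = n - 1" "Suc (n - 1) = n" using assms by auto
      then show ?thesis using e 2 by simp
    next
      case 3 then show ?thesis using S2 by simp
    qed
  qed
  show thesis using that[of c] less4 A B by blast
qed

context pair_graph
begin

text \<open>Each of the first two alternatives lies strictly below
  \<open>4 + degeneracy G div 2\<close>: 3 is less than 4, and degeneracy at least 2 raises the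
  bound to at least 5.\<close>

lemma connected_max_degree_2:
  assumes conn: "Digraph_Component.connected (with_proj G)" and deg: "max_degree G = 2"
  shows "pcf_chromatic_number G \<le> 3 \<or> degeneracy G \<ge> 2 \<and> pcf_chromatic_number G \<le> 4 \<or>
    digraph_iso (with_proj G) (with_proj (cycle_graph 5))"
proof -
  obtain n f where f: "bij_betw f {..<n} V"
    and step: "\<And>i. Suc i < n \<Longrightarrow> f (Suc i) \<in> N (f i)"
    and adj: "\<And>i j. i < n \<Longrightarrow> j < n \<Longrightarrow> f j \<in> N (f i) \<Longrightarrow> j = Suc i mod n \<or> i = Suc j mod n"
    using connected_max_degree_2_enum[OF conn] deg by (metis order_refl)
  have "V \<noteq> {}" using conn by (auto simp: connected_conv)
  then obtain x where x: "x \<in> V" "card (N x) = 2" using max_degree_vertex deg by metis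
  have "card (insert x (N x)) = 3" using x neighborhood_irrefl finite_neighborhood by simp
  moreover have "card (insert x (N x)) \<le> card V"
    using x neighborhood_subset pair_finite_verts by (intro card_mono) auto
  ultimately have n3: "n \<ge> 3" using bij_betw_same_card[OF f] by simp
  have inj: "f i = f j \<longleftrightarrow> i = j" if "i < n" "j < n" for i j
    using f that unfolding bij_betw_def by (auto dest: inj_onD)
  have fV: "f i \<in> V" if "i < n" for i using f that unfolding bij_betw_def by auto
  have ex: "\<exists>i<n. x = f i" if "x \<in> V" for x using f that unfolding bij_betw_def by auto
  show ?thesis
  \<comment> \<open>The closing edge decides between a path and a cycle.\<close>
  proof (cases "f 0 \<in> N (f (n - 1))")
    case False
    then have False': "f (n - 1) \<notin> N (f 0)" using neighborhood_sym by auto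
    have adj': "j = Suc i \<or> i = Suc j" if ij: "i < n" "j < n" "f j \<in> N (f i)" for i j
    proof (rule ccontr)
      assume no: "\<not> ?thesis"
      then have "Suc i = n \<and> j = 0 \<or> Suc j = n \<and> i = 0"
        using adj[OF ij] ij(1,2) by (cases "Suc i = n"; cases "Suc j = n") auto
      then have "i = n - 1 \<and> j = 0 \<or> j = n - 1 \<and> i = 0" by auto
      with False False' ij(3) show False by auto
    qed
    have "pcf_chromatic_number G \<le> 3"
    proof (rule pcf_chromatic_number_le_square_coloring[OF f, where c = "\<lambda>i. i mod 3"])
      fix i j assume "i < n" "j < n" "f j \<in> N (f i)"
      from adj'[OF this] show "i mod 3 \<noteq> j mod 3" by (auto simp: mod_Suc split: if_splits)
    next
      fix i j k assume "i < n" "j < n" "k < n" "j \<noteq> k" "f j \<in> N (f i)" "f k \<in> N (f i)"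
      then have "j = Suc i \<and> i = Suc k \<or> k = Suc i \<and> i = Suc j"
        using adj'[of i j] adj'[of i k] by auto
      moreover have "l mod 3 \<noteq> Suc (Suc l) mod 3" for l :: nat by (simp add: mod_Suc)
      ultimately show "j mod 3 \<noteq> k mod 3" by metis
    qed simp
    then show ?thesis by simp
  next
    case True
    have step': "f (Suc i mod n) \<in> N (f i)" if "i < n" for i
    proof (cases "Suc i = n")
      case True
      then have "i = n - 1" by simp
      with \<open>f 0 \<in> N (f (n - 1))\<close> True show ?thesis by simp
    qed (use step that in simp)
    have adj_iff: "f j \<in> N (f i) \<longleftrightarrow> j = Suc i mod n \<or> i = Suc j mod n" if "i < n" "j < n" for i j
      using adj[OF that] step'[OF that(1)] step'[OF that(2)] neighborhood_sym[of "f j" "f i"] by auto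
    have "2 \<le> card (N x)" if x: "x \<in> V" for x
    proof -
      obtain i where i: "i < n" "x = f i" using ex[OF x] by auto
      define j where "j = (if i = 0 then n - 1 else i - 1)"
      have j: "j < n" "Suc j mod n = i" using i n3 by (auto simp: j_def)
      then have "f j \<in> N x" "f (Suc i mod n) \<in> N x" using i n3 adj_iff by auto
      moreover have "j \<noteq> Suc i mod n" using i n3 by (cases "Suc i = n") (auto simp: j_def)
      then have "f j \<noteq> f (Suc i mod n)" using inj j n3 by auto
      ultimately show ?thesis
        using card_mono[OF finite_neighborhood, of "{f j, f (Suc i mod n)}" x] by auto
    qed
    then have "degeneracy G \<ge> 2" using degeneracy_ge[OF \<open>V \<noteq> {}\<close>] by blast
    moreover have "pcf_chromatic_number G \<le> 4" if "n \<noteq> 5"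
    proof -
      obtain c :: "nat \<Rightarrow> nat" where c: "\<And>i. c i < 4" "\<And>i. i < n \<Longrightarrow> c i \<noteq> c (Suc i mod n)"
        "\<And>i. i < n \<Longrightarrow> c i \<noteq> c (Suc (Suc i mod n) mod n)"
        using cycle_square_4_coloring[OF n3 \<open>n \<noteq> 5\<close>] by blast
      \<comment> \<open>Indices with the same successor coincide, so two distinct neighbors of
        \<open>i\<close> are its predecessor and its successor, two steps apart.\<close>
      have pred: "j = k" if "Suc j mod n = Suc k mod n" "j < n" "k < n" for j k
        using that by (cases "Suc j = n"; cases "Suc k = n") auto
      show ?thesis
      proof (rule pcf_chromatic_number_le_square_coloring[OF f, where c = c])
        fix i j assume "i < n" "j < n" "f j \<in> N (f i)"
        then show "c i \<noteq> c j" using adj c(2) by metis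
      next
        fix i j k assume *: "i < n" "j < n" "k < n" "j \<noteq> k" "f j \<in> N (f i)" "f k \<in> N (f i)"
        from adj[OF *(1,2,5)] adj[OF *(1,3,6)] have "j = Suc (Suc k mod n) mod n \<or> k = Suc (Suc j mod n) mod n"
          using * pred by metis
        then show "c j \<noteq> c k" using c(3) * by metis
      qed (rule c(1))
    qed
    moreover have "digraph_iso (with_proj G) (with_proj (cycle_graph 5))" if n5: "n = 5"
    proof -
      define h where "h = the_inv_into {..<n} f"
      have h: "h (f i) = i" if "i < n" for i
        using f that unfolding h_def bij_betw_def by (simp add: the_inv_into_f_f)
      have "bij_betw h V (pverts (cycle_graph 5))"
        using bij_betw_the_inv_into[OF f] n5 by (simp add: h_def cycle_graph_def)
      moreover have "(i, j) \<in> parcs (cycle_graph 5) \<longleftrightarrow> (i, j) \<in> map_prod h h ` parcs G" for i j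
      proof -
        have "(i, j) \<in> map_prod h h ` parcs G \<longleftrightarrow> (\<exists>x\<in>V. \<exists>y\<in>N x. i = h x \<and> j = h y)"
          by (force simp: neighborhood_def dest: in_arcsD1)
        also have "\<dots> \<longleftrightarrow> i < n \<and> j < n \<and> f j \<in> N (f i)"
        proof
          assume "\<exists>x\<in>V. \<exists>y\<in>N x. i = h x \<and> j = h y"
          then obtain x y where xy: "x \<in> V" "y \<in> N x" "i = h x" "j = h y" by auto
          then have "y \<in> V" using neighborhood_subset by auto
          with xy ex[of x] ex[of y] h show "i < n \<and> j < n \<and> f j \<in> N (f i)" by auto
        next
          assume "i < n \<and> j < n \<and> f j \<in> N (f i)"
          then show "\<exists>x\<in>V. \<exists>y\<in>N x. i = h x \<and> j = h y" using h fV by metis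
        qed
        also have "\<dots> \<longleftrightarrow> (i, j) \<in> parcs (cycle_graph 5)"
          using adj_iff n5 by (auto simp: cycle_graph_def)
        finally show ?thesis by simp
      qed
      ultimately show ?thesis unfolding digraph_iso_pair_iff by (intro exI[of _ h]) auto
    qed
    ultimately show ?thesis by blast
  qed
qed

end

section \<open>Comparison of the bounds according to the maximum degree\<close>

theorem corollary4p3:
  fixes G :: "'a pair_pre_digraph" and \<Delta> k :: nat
  assumes "pair_graph G"
    and "Digraph_Component.connected (with_proj G)"
    and "max_degree G = \<Delta>" and "\<Delta> \<ge> 1"
    and "degeneracy G = k"
  shows "pcf_chromatic_number G \<le> 2 * \<Delta> + k div 2 \<and>
    (pcf_chromatic_number G = 2 * \<Delta> + k div 2 \<longleftrightarrow>
       complete_digraph 2 (with_proj G) \<or>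
       digraph_iso (with_proj G) (with_proj (cycle_graph 5)))"
proof -
  interpret pair_graph G by fact
  note conn = assms(2)
  have k: "k \<le> \<Delta>" using degeneracy_le_max_degree assms by simp
  show ?thesis
  proof (cases "complete_digraph 2 (with_proj G) \<or> digraph_iso (with_proj G) (with_proj (cycle_graph 5))")
    case True
    then have "pcf_chromatic_number G = 2 * \<Delta> + k div 2"
      \<comment> \<open>For \<open>K_2\<close>, \<open>k \<le> \<Delta> = 1\<close> gives
        \<open>k div 2 = 0\<close> and the value 2; for \<open>C_5\<close> the value is 4 +
        1.\<close>
      using complete_digraph_2 digraph_iso_cycle_5 assms k by auto
    with True show ?thesis by simp
  next
    case False
    have greedy: "pcf_chromatic_number G \<le> \<Delta> + k + 1" "pcf_chromatic_number G \<le> 2 * \<Delta> + 1"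
      using pcf_chromatic_number_le_degeneracy pcf_chromatic_number_le_max_degree assms by auto
    have "\<Delta> \<noteq> 1" using False connected_max_degree_1[OF conn] assms by auto
    then consider "\<Delta> = 2" | "\<Delta> = 3" | "\<Delta> \<ge> 4" using assms(4) by linarith
    then have "pcf_chromatic_number G < 2 * \<Delta> + k div 2"
    proof cases
      case 1
      then show ?thesis using connected_max_degree_2[OF conn] False assms by auto
    next
      case 2
      then have "pcf_chromatic_number G \<le> 6" using pcf_chromatic_number_le_6[OF conn] assms by simp
      \<comment> \<open>For \<open>k \<ge> 2\<close> the bound is at least 7, and for
        \<open>k \<le> 1\<close> the greedy bound is at most 5.\<close>
      then show ?thesis using 2 greedy by linarith
    next
      case 3
      \<comment> \<open>For \<open>k \<ge> 4\<close> the bound \<open>2 * \<Delta> + 1\<close> is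
        already strict. For smaller \<open>k\<close>, \<open>\<Delta> + k + 1\<close> is strict
        because \<open>\<Delta> \<ge> 4\<close>.\<close>
      consider "k \<ge> 4" | "k = 3" | "k \<le> 2" by linarith
      then show ?thesis using 3 greedy by cases auto
    qed
    with False show ?thesis by auto
  qed
qed

end
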